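(* Let $N,H$ be positive integers, let $R,P_t,\lambda,T>0$ and $\alpha\in(0,1]$, and put $\mu=\lambda T$ and $\eta=H/N$. Let $\mathbf{k}$ be a random variable with $\mathbb{P}(\mathbf{k}=k)=\frac{e^{-\mu}\mu^k}{(1-e^{-\mu})k!}$ for $k=1,2,3,\dots$, and, given $\mathbf{k}=k$, let $\mathbf{r}$ be geometrically distributed on $\{1,2,3,\dots\}$ with success probability $\alpha^{H+kN}$. Define $$\mathrm{ECR}(T)=\mathbb{E}\left[\frac{\mathbf{r}(\mathbf{k}N+H)}{RP_t\,\mathbf{k}N}\right].$$ Then $$RP_t\,\mathrm{ECR}(T)=\frac{e^{\mu\alpha^{-N}}-1+\eta\big(\mathcal{E}(\mu\alpha^{-N})-\log(\mu\alpha^{-N})-\gamma\big)}{\alpha^{H}(e^{\mu}-1)}.$$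
   Context: $\log$ is the natural logarithm, $\gamma$ is the Euler(–Mascheroni) constant, and $\mathcal{E}(x)=\int_{-\infty}^{x}\frac{e^{t}}{t}\,dt$ (Cauchy principal value) is the exponential integral, for $x>0$. Interpretation: $\mathrm{ECR}(T)$ is the energy consumption rating as a function of the packetization interval $T$, where packets consist of an $H$-bit header and $\mathbf{k}$ symbols of $N$ bits each, $\mathbf{r}$ is the number of transmissions needed, $\alpha$ is the bit success probability, $R$ the channel rate and $P_t$ the transmit power. *)

theory Defs
  imports "HOL-Probability.Probability"
begin

text \<open>
  The principal value is the limit, as the excised interval \<open>(-\<epsilon>, \<epsilon>)\<close> shrinks
  to the singularity at the origin, of the remaining Lebesgue integral.
\<close>

definition expint :: "real \<Rightarrow> real" where
  "expint x =
     Lim (at_right 0) (\<lambda>\<epsilon>. (LINT t:{..-\<epsilon>}|lborel. exp t / t) + (LINT t:{\<epsilon>..x}|lborel. exp t / t))"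

text \<open>
  The library's geometric distribution counts failures and hence lives on \<open>{0, 1, 2, \<dots>}\<close>;
  here the number of trials up to and including the first success is needed.
\<close>

definition trials_pmf :: "real \<Rightarrow> nat pmf" where
  "trials_pmf p = map_pmf Suc (geometric_pmf p)"

text \<open>
  The interval \<open>T\<close> enters only through the law of the random variable \<open>k\<close>.
  The integral is Bochner's, which is \<open>0\<close> by convention for a non-integrable function; an equation
  giving \<open>ECR\<close> a nonzero value therefore also says that the expectation exists.
\<close>

definition ECR ::
  "'a measure \<Rightarrow> ('a \<Rightarrow> nat) \<Rightarrow> ('a \<Rightarrow> nat) \<Rightarrow> nat \<Rightarrow> nat \<Rightarrow> real \<Rightarrow> real \<Rightarrow> real" where
  "ECR M k r N H R Pt =
     (\<integral>\<omega>. real (r \<omega>) * (real (k \<omega>) * real N + real H) / (R * Pt * real (k \<omega>) * real N) \<partial>M)"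

end

theory Submission
  imports Defs
begin

text \<open>
  Conditioning on \<open>k = n\<close> replaces \<open>r\<close> by its mean \<open>\<alpha>\<^bsup>-(H + nN)\<^esup>\<close>, so with \<open>x = \<mu> \<alpha>\<^bsup>-N\<^esup>\<close> the
  expectation becomes a multiple of \<open>\<Sum>\<^bsub>n\<ge>1\<^esub> (1 + \<eta>/n) x\<^bsup>n\<^esup>/n! = e\<^bsup>x\<^esup> - 1 + \<eta> S(x)\<close>, where
  \<open>S(x) = \<Sum>\<^bsub>n\<ge>1\<^esub> x\<^bsup>n\<^esup>/(n n!)\<close>. As \<open>ln \<bar>t\<bar> + S(t)\<close> is a primitive of \<open>e\<^bsup>t\<^esup>/t\<close>, the exponential
  integral is \<open>ln x + S(x)\<close> up to a constant; the constant is \<open>\<gamma> = - \<Gamma>'(1)\<close>, found by letting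
  \<open>s \<rightarrow> 0\<close> in Euler's integral for \<open>\<Gamma>(s) - 1/s = (\<Gamma>(1 + s) - 1)/s\<close>.
\<close>

section \<open>The power series S and primitives built from it\<close>

definition expint_series :: "real \<Rightarrow> real" where
  "expint_series x = (\<Sum>n. x ^ n / (real n * fact n))"

text \<open>The term of index \<open>0\<close> is \<open>1 / 0 = 0\<close>.\<close>

lemma expint_series_sums: "(\<lambda>n. x ^ n / (real n * fact n)) sums expint_series x"
proof -
  have "summable (\<lambda>n. x ^ n / (real n * fact n))"
  proof (rule summable_comparison_test')
    show "summable (\<lambda>n. inverse (fact n) * \<bar>x\<bar> ^ n)"
      by (rule summable_exp)
    show "norm (x ^ n / (real n * fact n)) \<le> inverse (fact n) * \<bar>x\<bar> ^ n" if "n \<ge> 1" for n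
    proof -
      have "\<bar>x\<bar> ^ n / (real n * fact n) \<le> \<bar>x\<bar> ^ n / (1 * fact n)"
        using that by (intro divide_left_mono mult_right_mono) auto
      then show ?thesis
        by (simp add: abs_mult power_abs divide_inverse mult_ac)
    qed
  qed
  then show ?thesis
    unfolding expint_series_def by (rule summable_sums)
qed

lemma expint_series_0 [simp]: "expint_series 0 = 0"
proof -
  have "(\<lambda>n. 0 ^ n / (real n * fact n)) = (\<lambda>n. 0 :: real)"
    by (auto simp: fun_eq_iff power_0_left)
  then show ?thesis
    by (simp add: expint_series_def)
qed

text \<open>The derivative is kept as a power series because this form also covers
  \<open>x = 0\<close>, where it is 1 while \<open>(exp x - 1) / x\<close> evaluates to 0.
  Continuity of S at the origin rests on it.\<close>

lemma has_real_derivative_expint_series_suminf: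
  "(expint_series has_real_derivative (\<Sum>n. x ^ n / fact (Suc n))) (at x)"
proof -
  define c :: "nat \<Rightarrow> real" where "c n = 1 / (real n * fact n)" for n
  have "summable (\<lambda>n. c n * y ^ n)" for y
    using sums_summable[OF expint_series_sums[of y]] by (simp add: c_def)
  from termdiffs_strong_converges_everywhere[OF this]
  have "((\<lambda>x. \<Sum>n. c n * x ^ n) has_real_derivative (\<Sum>n. diffs c n * x ^ n)) (at x)" .
  moreover have "(\<lambda>x. \<Sum>n. c n * x ^ n) = expint_series"
    by (simp add: fun_eq_iff c_def expint_series_def)
  moreover have "diffs c n * x ^ n = x ^ n / fact (Suc n)" for n
    by (simp add: c_def diffs_def del: fact_Suc of_nat_Suc)
  ultimately show ?thesis
    by (simp only:)
qed

lemma has_real_derivative_expint_series: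
  assumes "x \<noteq> 0"
  shows "(expint_series has_real_derivative (exp x - 1) / x) (at x)"
proof -
  have "(\<lambda>n. x ^ n / fact n) sums exp x"
    using exp_converges[of x] by (simp add: divide_inverse mult.commute)
  then have "(\<lambda>n. x ^ Suc n / fact (Suc n)) sums (exp x - 1)"
    by (subst sums_Suc_iff) simp
  then have "(\<lambda>n. x ^ Suc n / fact (Suc n) / x) sums ((exp x - 1) / x)"
    by (rule sums_divide)
  moreover have "x ^ Suc n / fact (Suc n) / x = x ^ n / fact (Suc n)" for n
    using assms by (simp del: fact_Suc)
  ultimately have "(\<Sum>n. x ^ n / fact (Suc n)) = (exp x - 1) / x"
    by (simp only: sums_iff)
  with has_real_derivative_expint_series_suminf show ?thesis
    by metis
qed

lemma continuous_on_expint_series: "continuous_on A expint_series"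
  by (meson DERIV_isCont continuous_at_imp_continuous_on has_real_derivative_expint_series_suminf)

lemmas continuous_on_expint_series' [continuous_intros] =
  continuous_on_compose2[OF continuous_on_expint_series _ subset_UNIV]

lemma has_integral_exp_over:
  fixes a b :: real
  assumes "0 < a" "a \<le> b"
  shows "((\<lambda>t. exp t / t) has_integral
           (ln b + expint_series b - (ln a + expint_series a))) {a..b}"
proof (rule fundamental_theorem_of_calculus_interior)
  show "a \<le> b" by fact
  show "continuous_on {a..b} (\<lambda>t. ln t + expint_series t)"
    using assms by (intro continuous_intros) auto
next
  fix t assume "t \<in> {a<..<b}"
  with assms have "t > 0" by simp
  then show "((\<lambda>t. ln t + expint_series t) has_vector_derivative exp t / t) (at t)"
    by (auto intro!: derivative_eq_intros has_real_derivative_expint_series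
             simp: field_simps simp flip: has_real_derivative_iff_has_vector_derivative)
qed

text \<open>Reflecting the negative half of the principal value at the origin leads to this
  integrand.\<close>

lemma has_integral_exp_minus_over:
  fixes a b :: real
  assumes "0 < a" "a \<le> b"
  shows "((\<lambda>t. exp (- t) / t) has_integral
           (ln b + expint_series (- b) - (ln a + expint_series (- a)))) {a..b}"
proof (rule fundamental_theorem_of_calculus_interior)
  show "a \<le> b" by fact
  show "continuous_on {a..b} (\<lambda>t. ln t + expint_series (- t))"
    using assms by (intro continuous_intros) auto
next
  fix t assume "t \<in> {a<..<b}"
  with assms have "t > 0" by simp
  then show "((\<lambda>t. ln t + expint_series (- t)) has_vector_derivative exp (- t) / t) (at t)"
    by (auto intro!: derivative_eq_intros DERIV_chain2[OF has_real_derivative_expint_series]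
             simp: field_simps simp flip: has_real_derivative_iff_has_vector_derivative)
qed

section \<open>Euler's constant as an integral\<close>

lemma Gamma_minus_inverse_tendsto:
  "((\<lambda>s::real. Gamma s - 1 / s) \<longlongrightarrow> - euler_mascheroni) (at_right 0)"
proof -
  have "(Gamma has_real_derivative Gamma 1 * Digamma 1) (at (1::real))"
    by (rule has_field_derivative_Gamma) auto
  then have "((\<lambda>s::real. (Gamma (1 + s) - 1) / s) \<longlongrightarrow> - euler_mascheroni) (at 0)"
    by (simp add: DERIV_def)
  then have "((\<lambda>s::real. (Gamma (1 + s) - 1) / s) \<longlongrightarrow> - euler_mascheroni) (at_right 0)"
    by (rule filterlim_mono) (auto simp: at_le)
  moreover have "\<forall>\<^sub>F s::real in at_right 0. (Gamma (1 + s) - 1) / s = Gamma s - 1 / s"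
    using eventually_at_right_less[of 0]
  proof eventually_elim
    case (elim s)
    then have "s \<notin> \<int>\<^sub>\<le>\<^sub>0"
      by (auto elim!: nonpos_Ints_cases)
    with elim show ?case
      using Gamma_plus1[of s] by (simp add: add.commute field_simps)
  qed
  ultimately show ?thesis
    by (blast intro: Lim_transform_eventually)
qed

text \<open>
  The regularised integrand \<open>t\<^bsup>s-1\<^esup> e\<^bsup>-t\<^esup> - [t \<le> 1] t\<^bsup>s-1\<^esup>\<close> has integral \<open>\<Gamma>(s) - 1/s\<close>
  and stays below \<open>3 e\<^bsup>-t\<^esup>\<close> uniformly in \<open>s\<close>, so \<open>s \<rightarrow> 0\<close> may be taken under the integral.
\<close>

lemma has_integral_euler_mascheroni:
  "((\<lambda>t. (exp (- t) - (if t \<le> 1 then 1 else 0)) / t) has_integral - euler_mascheroni) {0::real..}"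
proof -
  \<comment> \<open>Dominated convergence works along sequences, so \<open>s\<close> runs to 0
    through the values 1/(n+1); staying in (0, 1] keeps t^(s-1) between 1/t and 1 or between 1 and
    1/t.\<close>
  define s :: "nat \<Rightarrow> real" where "s n = 1 / real (Suc n)" for n
  have s: "0 < s n" "s n \<le> 1" for n
    by (auto simp: s_def field_simps)
  have s_lim: "filterlim s (at_right 0) sequentially"
    unfolding s_def using LIMSEQ_inverse_real_of_nat
    by (auto simp: filterlim_at inverse_eq_divide)
  define f :: "nat \<Rightarrow> real \<Rightarrow> real" where
    "f n t = t powr (s n - 1) / exp t - (if t \<in> {0..1} then t powr (s n - 1) else 0)" for n t
  define h :: "real \<Rightarrow> real" where "h t = (exp (- t) - (if t \<le> 1 then 1 else 0)) / t" for t
  have f_int: "(f n has_integral Gamma (s n) - 1 / s n) {0..}" for n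
  proof -
    have "((\<lambda>t. t powr (s n - 1)) has_integral 1 / s n) {0..1}"
      using has_integral_powr_from_0[of "s n - 1" 1] s[of n] by simp
    then have "((\<lambda>t. if t \<in> {0..1} then t powr (s n - 1) else 0) has_integral 1 / s n) {0..}"
      by (subst has_integral_restrict) auto
    then show ?thesis
      unfolding f_def by (intro has_integral_diff Gamma_integral_real s)
  qed
  have bound: "norm (f n t) \<le> 3 * exp (- t)" if "t \<in> {0..}" for n t
  proof (cases "t = 0")
    case False
    with that have t: "t > 0" by simp
    show ?thesis
    proof (cases "t \<le> 1")
      case True
      have "norm (f n t) = t powr (s n - 1) * (1 - exp (- t))"
        using True t by (simp add: f_def exp_minus field_simps abs_mult abs_if)
      \<comment> \<open>The factor 1 - exp(-t) \<le> t absorbs the singularity at 0. The constant 3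
        then comes from exp t \<le> e \<le> 3 on (0, 1].\<close>
      also have "\<dots> \<le> t powr (- 1) * t"
        using s[of n] t True exp_ge_add_one_self[of "- t"]
        by (intro mult_mono powr_mono') auto
      also have "\<dots> = 1"
        using t by (simp add: powr_minus)
      also have "\<dots> \<le> 3 * exp (- t)"
      proof -
        have "exp t \<le> exp 1" using True by simp
        also have "\<dots> \<le> 3" using exp_le by simp
        finally show ?thesis by (simp add: exp_minus field_simps)
      qed
      finally show ?thesis .
    next
      case False
      have "norm (f n t) = t powr (s n - 1) * exp (- t)"
        using False t by (simp add: f_def exp_minus field_simps)
      also have "\<dots> \<le> 1 * exp (- t)"
        using False s[of n] powr_mono[of "s n - 1" 0 t] by (intro mult_right_mono) auto
      finally show ?thesis by (simp add: mult_right_mono order_trans)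
    qed
  qed (simp add: f_def)
  \<comment> \<open>At \<open>t = 0\<close> both sides are 0, since \<open>0 powr a = 0\<close> and
    division by zero gives 0.\<close>
  have lim: "(\<lambda>n. f n t) \<longlonglongrightarrow> h t" if "t \<in> {0..}" for t
  proof (cases "t = 0")
    case False
    with that have t: "t > 0" by simp
    have s0: "s \<longlonglongrightarrow> 0"
      using s_lim by (simp add: filterlim_at)
    have P: "(\<lambda>n. t powr (s n - 1)) \<longlonglongrightarrow> 1 / t"
      using t tendsto_powr[OF tendsto_const tendsto_diff[OF s0 tendsto_const], of t 1]
      by (simp add: powr_minus_divide)
    have Q: "(\<lambda>n. t powr (s n - 1) / exp t) \<longlonglongrightarrow> 1 / t / exp t"
      by (intro tendsto_divide P tendsto_const) simp
    have "(\<lambda>n. f n t) \<longlonglongrightarrow> 1 / t / exp t - (if t \<in> {0..1} then 1 / t else 0)"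
      unfolding f_def using tendsto_diff[OF Q P] tendsto_diff[OF Q tendsto_const[of 0]]
      by (cases "t \<in> {0..1}") (simp_all only: if_True if_False)
    then show ?thesis
      using t by (simp add: h_def exp_minus field_simps split: if_splits)
  qed (simp add: f_def h_def)
  have B: "(\<lambda>t::real. 3 * exp (- t)) integrable_on {0..}"
    using has_integral_exp_minus_to_infinity[of 1 0]
    by (intro integrable_on_mult_right) (auto intro: has_integral_integrable)
  note dc = dominated_convergence[of f "{0..}", OF has_integral_integrable[OF f_int] B bound lim]
  have "(\<lambda>n. Gamma (s n) - 1 / s n) \<longlonglongrightarrow> integral {0..} h"
    using dc(2) by (simp add: integral_unique[OF f_int])
  moreover have "(\<lambda>n. Gamma (s n) - 1 / s n) \<longlonglongrightarrow> - euler_mascheroni"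
    by (rule filterlim_compose[OF Gamma_minus_inverse_tendsto s_lim])
  ultimately have "integral {0..} h = - euler_mascheroni"
    by (rule LIMSEQ_unique)
  then show ?thesis
    using integrable_integral[OF dc(1)] by (simp add: h_def[abs_def])
qed

text \<open>On (0, 1) the regularised integrand is (exp(-t) - 1)/t, with primitive S(-t). Removing
  its share S(-1) from the total \<open>- euler_mascheroni\<close> leaves exactly the tail beyond
  1.\<close>

lemma has_integral_exp_minus_over_Ioi_1:
  "((\<lambda>t. exp (- t) / t) has_integral - euler_mascheroni - expint_series (- 1)) {1::real<..}"
proof -
  define h :: "real \<Rightarrow> real" where "h t = (exp (- t) - (if t \<le> 1 then 1 else 0)) / t" for t
  have "(h has_integral expint_series (- 1) - expint_series (- 0)) {0..1}"
  proof (rule fundamental_theorem_of_calculus_interior)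
    show "continuous_on {0..1} (\<lambda>t. expint_series (- t))"
      by (intro continuous_intros)
    fix t :: real assume t: "t \<in> {0<..<1}"
    then have "((\<lambda>t. expint_series (- t)) has_real_derivative (exp (- t) - 1) / (- t) * (- 1)) (at t)"
      by (intro DERIV_chain2[OF has_real_derivative_expint_series])
         (auto intro!: derivative_eq_intros)
    with t show "((\<lambda>t. expint_series (- t)) has_vector_derivative h t) (at t)"
      by (simp add: h_def flip: has_real_derivative_iff_has_vector_derivative)
  qed simp
  then have "((\<lambda>t. if t \<in> {0..1} then h t else 0) has_integral expint_series (- 1)) {0..}"
    by (subst has_integral_restrict) auto
  with has_integral_euler_mascheroni
  have "((\<lambda>t. h t - (if t \<in> {0..1} then h t else 0)) has_integral
          - euler_mascheroni - expint_series (- 1)) {0..}"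
    unfolding h_def by (rule has_integral_diff)
  moreover have "h t - (if t \<in> {0..1} then h t else 0) =
      (if t \<in> {1<..} then exp (- t) / t else 0)" if "t \<in> {0..}" for t
    using that by (auto simp: h_def)
  ultimately have "((\<lambda>t. if t \<in> {1<..} then exp (- t) / t else 0) has_integral
      - euler_mascheroni - expint_series (- 1)) {0::real..}"
    by (rule has_integral_eq[rotated])
  then show ?thesis
    by (subst (asm) has_integral_restrict) auto
qed

section \<open>The exponential integral in closed form\<close>

text \<open>The fundamental theorem yields gauge integrals, whereas \<open>expint\<close> is built
  from Lebesgue integrals; for nonnegative integrands the two agree.\<close>

lemma set_integral_eq_has_integral:
  fixes f :: "real \<Rightarrow> real"
  assumes "(f has_integral I) A" "\<And>x. x \<in> A \<Longrightarrow> 0 \<le> f x"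
    and "A \<in> sets borel" "f \<in> borel_measurable borel"
  shows "(LINT x:A|lborel. f x) = I"
proof -
  have "integral\<^sup>N lborel (\<lambda>x. indicator A x * f x) = I"
    using assms by (intro nn_integral_has_integral_lebesgue)
  moreover have "I \<ge> 0"
    using assms(1,2) by (rule has_integral_nonneg)
  ultimately show ?thesis
    unfolding set_lebesgue_integral_def using assms
    by (subst integral_eq_nn_integral) (auto simp: indicator_def intro!: AE_I2)
qed

text \<open>The two sides of the singularity contribute \<open>ln e\<close> with opposite signs, so
  the divergence cancels and only S(-e) - S(e), which tends to 0, depends on the excision.\<close>

lemma expint_eq_series:
  assumes "x > 0"
  shows "expint x = euler_mascheroni + ln x + expint_series x"
proof -
  let ?F = "\<lambda>e. (LINT t:{..-e}|lborel. exp t / t) + (LINT t:{e..x}|lborel. exp t / t)"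
  have eq: "?F e = euler_mascheroni + ln x + expint_series x + (expint_series (- e) - expint_series e)"
    if e: "0 < e" "e < min 1 x" for e
  proof -
    have disj: "{e..1} \<inter> {1<..} = {}"
      by auto
    \<comment> \<open>Splitting at 1 joins the explicit primitive to the known tail; the two values
      S(-1) cancel.\<close>
    have "((\<lambda>t. exp (- t) / t) has_integral
            (ln 1 + expint_series (- 1) - (ln e + expint_series (- e))) +
            (- euler_mascheroni - expint_series (- 1))) ({e..1} \<union> {1<..})"
      using e by (intro has_integral_Un has_integral_exp_minus_over has_integral_exp_minus_over_Ioi_1)
                 (auto simp: disj)
    moreover have "{e..1} \<union> {1<..} = {e..}"
      using e by auto
    ultimately have "((\<lambda>t. exp (- t) / t) has_integral
            (- euler_mascheroni - ln e - expint_series (- e))) {e..}"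
      by (simp add: algebra_simps)
    then have I: "(LINT t:{e..}|lborel. exp (- t) / t) = - euler_mascheroni - ln e - expint_series (- e)"
      using e by (intro set_integral_eq_has_integral) auto
    \<comment> \<open>The integrand is negative on this half-line; reflection and a change of sign
      reduce it to the nonnegative case \<open>I\<close>.\<close>
    have "(LINT t:{..-e}|lborel. exp t / t) = (LINT t:{t. - t \<in> {..-e}}|lborel. exp (- t) / (- t))"
      by (rule set_integral_reflect)
    also have "{t. - t \<in> {..-e}} = {e..}"
      by auto
    also have "(LINT t:{e..}|lborel. exp (- t) / (- t)) = - (LINT t:{e..}|lborel. exp (- t) / t)"
      by (simp add: set_lebesgue_integral_def)
    finally have "(LINT t:{..-e}|lborel. exp t / t) = euler_mascheroni + ln e + expint_series (- e)"
      using I by simp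
    moreover have "(LINT t:{e..x}|lborel. exp t / t) = ln x + expint_series x - (ln e + expint_series e)"
      using e by (intro set_integral_eq_has_integral has_integral_exp_over) auto
    ultimately show ?thesis
      by simp
  qed
  have "isCont (\<lambda>e. expint_series (- e) - expint_series e) 0"
    using continuous_on_expint_series[of UNIV]
    by (auto intro!: continuous_intros isCont_o2[where f = uminus and g = expint_series]
             simp: continuous_on_eq_continuous_at)
  then have "((\<lambda>e. expint_series (- e) - expint_series e) \<longlongrightarrow> 0) (at_right 0)"
    by (auto simp: isCont_def intro: filterlim_mono at_le)
  then have "((\<lambda>e. euler_mascheroni + ln x + expint_series x +
      (expint_series (- e) - expint_series e)) \<longlongrightarrow> euler_mascheroni + ln x + expint_series x + 0) (at_right 0)"
    by (intro tendsto_intros)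
  moreover have "\<forall>\<^sub>F e in at_right 0. euler_mascheroni + ln x + expint_series x +
      (expint_series (- e) - expint_series e) = ?F e"
    using eventually_at_right_real[of 0 "min 1 x"] assms
    by (auto elim!: eventually_mono simp: eq)
  ultimately have "(?F \<longlongrightarrow> euler_mascheroni + ln x + expint_series x) (at_right 0)"
    by (auto intro: Lim_transform_eventually)
  then show ?thesis
    unfolding expint_def by (intro tendsto_Lim) auto
qed

section \<open>Expectations under the joint law of \<open>k\<close> and \<open>r\<close>\<close>

text \<open>Stating the mean in \<open>ennreal\<close> lets it enter the double sum without a
  summability argument.\<close>

lemma suminf_trials_pmf:
  assumes "0 < p" "p \<le> 1"
  shows "(\<Sum>j. ennreal (real j * pmf (trials_pmf p) j)) = ennreal (1 / p)"
proof -
  have int: "integrable (measure_pmf (geometric_pmf p)) real"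
    using assms by (intro integrable_real_geometric_pmf) auto
  have "(\<Sum>j. ennreal (real j * pmf (trials_pmf p) j)) = (\<integral>\<^sup>+ j. ennreal (real j) \<partial>trials_pmf p)"
    by (simp add: nn_integral_measure_pmf nn_integral_count_space_nat ennreal_mult mult.commute)
  also have "\<dots> = (\<integral>\<^sup>+ j. ennreal (real (Suc j)) \<partial>geometric_pmf p)"
    by (simp add: trials_pmf_def)
  also have "\<dots> = ennreal (\<integral> j. real (Suc j) \<partial>geometric_pmf p)"
    using int by (intro nn_integral_eq_integral) auto
  \<comment> \<open>The mean number of failures is (1 - p)/p; the successful trial adds 1.\<close>
  also have "(\<integral> j. real (Suc j) \<partial>geometric_pmf p) = 1 / p"
    using int assms expectation_geometric_pmf[of p] by (simp add: field_simps)
  finally show ?thesis .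
qed

text \<open>At each point the indicators select the single term n = \<open>k \<omega>\<close>, j =
  \<open>r \<omega>\<close>; monotone convergence then moves both sums out of the integral.\<close>

lemma nn_integral_discrete_pair:
  fixes k r :: "'a \<Rightarrow> nat" and f :: "nat \<Rightarrow> nat \<Rightarrow> ennreal"
  assumes [measurable]: "k \<in> measurable M (count_space UNIV)" "r \<in> measurable M (count_space UNIV)"
  shows "(\<integral>\<^sup>+ \<omega>. f (k \<omega>) (r \<omega>) \<partial>M) =
    (\<Sum>n. \<Sum>j. f n j * emeasure M {\<omega> \<in> space M. r \<omega> = j \<and> k \<omega> = n})"
proof -
  have "(\<integral>\<^sup>+ \<omega>. f (k \<omega>) (r \<omega>) \<partial>M) =
    (\<integral>\<^sup>+ \<omega>. (\<Sum>n. \<Sum>j. f n j * indicator {\<omega> \<in> space M. r \<omega> = j \<and> k \<omega> = n} \<omega>) \<partial>M)"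
  proof (rule nn_integral_cong)
    fix \<omega> assume \<omega>: "\<omega> \<in> space M"
    have "(\<Sum>j. f n j * indicator {\<omega> \<in> space M. r \<omega> = j \<and> k \<omega> = n} \<omega>) =
        (if n = k \<omega> then f n (r \<omega>) else 0)" for n
    proof -
      have "(\<Sum>j. f n j * indicator {\<omega> \<in> space M. r \<omega> = j \<and> k \<omega> = n} \<omega>) =
          (\<Sum>j\<in>{r \<omega>}. f n j * indicator {\<omega> \<in> space M. r \<omega> = j \<and> k \<omega> = n} \<omega>)"
        by (rule suminf_finite) (auto simp: indicator_def)
      also have "\<dots> = (if n = k \<omega> then f n (r \<omega>) else 0)"
        using \<omega> by (simp add: indicator_def)
      finally show ?thesis .
    qed
    moreover have "(\<Sum>n. if n = k \<omega> then f n (r \<omega>) else 0) =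
        (\<Sum>n\<in>{k \<omega>}. if n = k \<omega> then f n (r \<omega>) else 0)"
      by (rule suminf_finite) auto
    ultimately show "f (k \<omega>) (r \<omega>) =
        (\<Sum>n. \<Sum>j. f n j * indicator {\<omega> \<in> space M. r \<omega> = j \<and> k \<omega> = n} \<omega>)"
      by simp
  qed
  also have "\<dots> = (\<Sum>n. \<Sum>j. f n j * emeasure M {\<omega> \<in> space M. r \<omega> = j \<and> k \<omega> = n})"
    by (subst nn_integral_suminf; (measurable | intro suminf_cong))+
       (simp add: nn_integral_cmult_indicator)
  finally show ?thesis .
qed

theorem mainTheorem2:
  fixes M :: "'a measure"
    and k r :: "'a \<Rightarrow> nat"
    and N H :: nat
    and R Pt lam T \<alpha> \<mu> \<eta> :: real
  assumes "N > 0" and "H > 0"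
    and "R > 0" and "Pt > 0" and "lam > 0" and "T > 0"
    and "0 < \<alpha>" and "\<alpha> \<le> 1"
    and "\<mu> = lam * T"
    and "\<eta> = real H / real N"
    and "prob_space M"
    and "k \<in> measurable M (count_space UNIV)"
    and "r \<in> measurable M (count_space UNIV)"
    and "\<And>n. n \<ge> 1 \<Longrightarrow>
           \<P>(\<omega> in M. k \<omega> = n) = exp (- \<mu>) * \<mu> ^ n / ((1 - exp (- \<mu>)) * fact n)"
    and "\<And>n j. n \<ge> 1 \<Longrightarrow>
           \<P>(\<omega> in M. r \<omega> = j \<bar> k \<omega> = n) = pmf (trials_pmf (\<alpha> ^ (H + n * N))) j"
  shows "R * Pt * ECR M k r N H R Pt =
           (exp (\<mu> * \<alpha> powi (- int N)) - 1
             + \<eta> * (expint (\<mu> * \<alpha> powi (- int N)) - ln (\<mu> * \<alpha> powi (- int N)) - euler_mascheroni))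
           / (\<alpha> ^ H * (exp \<mu> - 1))"
proof -
  interpret prob_space M by fact
  note meas [measurable] = assms(12,13)
  define x where "x = \<mu> * \<alpha> powi (- int N)"
  have x_eq: "x = \<mu> / \<alpha> ^ N"
    by (simp add: x_def power_int_minus divide_inverse)
  have pos: "\<mu> > 0" "x > 0" "exp \<mu> > 1"
    using assms by (auto simp: x_eq)
  define p where "p n = \<alpha> ^ (H + n * N)" for n
  have p: "0 < p n" "p n \<le> 1" for n
    using assms by (auto simp: p_def power_le_one)
  define q where "q n = exp (- \<mu>) * \<mu> ^ n / ((1 - exp (- \<mu>)) * fact n)" for n
  have q: "q n > 0" for n
    using pos by (auto simp: q_def)
  \<comment> \<open>Division by zero gives \<open>g 0 = 0\<close>, so the law of \<open>k\<close> at \<open>0\<close> is irrelevant.\<close>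
  define g where "g n = (real n * real N + real H) / (R * Pt * real n * real N)" for n
  have g: "g n \<ge> 0" for n
    using assms by (auto simp: g_def)
  have joint: "emeasure M {\<omega> \<in> space M. r \<omega> = j \<and> k \<omega> = n} = ennreal (q n * pmf (trials_pmf (p n)) j)"
    if "n \<ge> 1" for n j
  proof -
    \<comment> \<open>The conditional probability is a quotient by \<open>q n > 0\<close>, so it can
      be multiplied out.\<close>
    have "\<P>(\<omega> in M. r \<omega> = j \<and> k \<omega> = n) = q n * pmf (trials_pmf (p n)) j"
      using assms(15)[OF that, of j] q[of n]
      unfolding cond_prob_def assms(14)[OF that] q_def[symmetric] p_def[symmetric]
      by (simp add: field_simps)
    then show ?thesis
      by (simp add: emeasure_eq_measure)
  qed
  have inner: "(\<Sum>j. ennreal (real j * g n) * emeasure M {\<omega> \<in> space M. r \<omega> = j \<and> k \<omega> = n}) =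
      ennreal (g n * q n / p n)" for n
  proof (cases "n = 0")
    case False
    then have "(\<Sum>j. ennreal (real j * g n) * emeasure M {\<omega> \<in> space M. r \<omega> = j \<and> k \<omega> = n}) =
        (\<Sum>j. ennreal (g n * q n) * ennreal (real j * pmf (trials_pmf (p n)) j))"
      using g[of n] q[of n] by (simp add: joint ennreal_mult[symmetric] mult_ac)
    also have "\<dots> = ennreal (g n * q n) * ennreal (1 / p n)"
      by (simp only: ennreal_suminf_cmult suminf_trials_pmf[OF p])
    also have "\<dots> = ennreal (g n * q n / p n)"
      using g[of n] q[of n] p[of n] by (simp add: ennreal_mult[symmetric])
    finally show ?thesis .
  qed (simp add: g_def)
  define K where "K = R * Pt * \<alpha> ^ H * (exp \<mu> - 1)"
  define S where "S = exp x - 1 + \<eta> * expint_series x"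
  \<comment> \<open>Here exp(-\<mu>)/(1 - exp(-\<mu>)) = 1/(exp \<mu> - 1), and \<mu>^n over
    \<alpha>^(nN) is x^n. The correction at index 0 removes the constant term of the exponential
    series, so both sides vanish there.\<close>
  have term_eq: "g n * q n / p n =
      ((x ^ n / fact n - (if n = 0 then 1 else 0)) + \<eta> * (x ^ n / (real n * fact n))) / K" for n
  proof (cases "n = 0")
    case False
    have "q n = \<mu> ^ n / ((exp \<mu> - 1) * fact n)"
      by (simp add: q_def exp_minus field_simps)
    moreover have "p n = \<alpha> ^ H * (\<alpha> ^ N) ^ n"
      by (simp add: p_def power_add power_mult[symmetric] mult.commute)
    moreover have "g n = (1 + \<eta> / real n) / (R * Pt)"
      using False assms by (simp add: g_def field_simps)
    ultimately have "g n * q n / p n =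
        (1 + \<eta> / real n) / (R * Pt) * (\<mu> ^ n / ((exp \<mu> - 1) * fact n)) / (\<alpha> ^ H * (\<alpha> ^ N) ^ n)"
      by (simp only:)
    also have "\<dots> = (1 + \<eta> / real n) * (x ^ n / fact n) / K"
      unfolding K_def x_eq power_divide
      by (simp only: divide_inverse inverse_mult_distrib mult_ac)
    also have "(1 + \<eta> / real n) * (x ^ n / fact n) =
        x ^ n / fact n + \<eta> * (x ^ n / (real n * fact n))"
      by (simp add: distrib_right add_divide_distrib)
    finally show ?thesis
      using False by (simp only: if_False diff_0_right)
  qed (simp add: g_def)
  have "(\<lambda>n. x ^ n / fact n) sums exp x"
    using exp_converges[of x] by (simp add: divide_inverse mult.commute)
  moreover have "(\<lambda>n. if n = 0 then 1 else 0 :: real) sums 1"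
    using sums_single[of 0 "\<lambda>_. 1 :: real"] by simp
  ultimately have sums: "(\<lambda>n. g n * q n / p n) sums (S / K)"
    unfolding term_eq S_def
    by (intro sums_divide sums_add sums_diff sums_mult expint_series_sums)
  have nonneg: "g n * q n / p n \<ge> 0" for n
    using g[of n] q[of n] p[of n] by (simp add: less_imp_le)
  have sum: "(\<Sum>n. ennreal (g n * q n / p n)) = ennreal (S / K)"
    by (rule suminf_ennreal_eq[OF nonneg sums])
  have SK: "S / K \<ge> 0"
    by (rule sums_le[OF nonneg sums_zero sums])
  have "(\<integral>\<^sup>+ \<omega>. ennreal (real (r \<omega>) * g (k \<omega>)) \<partial>M) = ennreal (S / K)"
    using nn_integral_discrete_pair[OF meas, of "\<lambda>n j. ennreal (real j * g n)"]
    by (simp add: inner sum)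
  \<comment> \<open>The integrand is nonnegative and its extended integral is finite, so the Bochner
    integral takes the same value.\<close>
  then have "(\<integral>\<omega>. real (r \<omega>) * g (k \<omega>) \<partial>M) = S / K"
    using g SK by (subst integral_eq_nn_integral) auto
  then have "ECR M k r N H R Pt = S / K"
    by (simp add: ECR_def g_def)
  moreover have "expint_series x = expint x - ln x - euler_mascheroni"
    using expint_eq_series[OF pos(2)] by simp
  ultimately show ?thesis
    using assms(3,4) unfolding x_def[symmetric] by (simp add: S_def K_def)
qed

end
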